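(* Let $(A,\dashv,\perp,\vdash)$ be a triassociative algebra over a field $\mathbb{K}$, let $\lambda\in\mathbb{K}$, and let $R$ (resp. $N$, resp. $P$) be a Rota-Baxter operator of weight $\lambda$ (resp. a Nijenhuis operator, resp. a Reynolds operator) on $A$. Then $(A,\triangleleft,\triangle,\triangleright)$ is a triassociative algebra for each of the following three sets of operations (for all $x,y\in A$): a) $x\triangleleft y=R(x)\dashv y+x\dashv R(y)+\lambda\, x\dashv y$, $\;x\triangle y=R(x)\perp y+x\perp R(y)+\lambda\, x\perp y$, $\;x\triangleright y=R(x)\vdash y+x\vdash R(y)+\lambda\, x\vdash y$; b) $x\triangleleft y=N(x)\dashv y+x\dashv N(y)-N(x\dashv y)$, $\;x\triangle y=N(x)\perp y+x\perp N(y)-N(x\perp y)$, $\;x\triangleright y=N(x)\vdash y+x\vdash N(y)-N(x\vdash y)$; c) $x\triangleleft y=P(x)\dashv y+x\dashv P(y)-P(x)\dashv P(y)$, $\;x\triangle y=P(x)\perp y+x\perp P(y)-P(x)\perp P(y)$, $\;x\triangleright y=P(x)\vdash y+x\vdash P(y)-P(x)\vdash P(y)$. Moreover, in case a) (resp. b), resp. c)) the map $R$ (resp. $N$, resp. $P$) is a morphism of triassociative algebras $(A,\triangleleft,\triangle,\triangleright)\to(A,\dashv,\perp,\vdash)$, and $R$ (resp. $N$, resp. $P$) is a Rota-Baxter operator of weight $\lambda$ (resp. a Nijenhuis operator, resp. a Reynolds operator) on $(A,\triangleleft,\triangle,\triangleright)$.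
   Context: A triassociative algebra over $\mathbb{K}$ is a $\mathbb{K}$-vector space $A$ with three bilinear maps $\dashv,\perp,\vdash:A\times A\to A$ such that for all $x,y,z\in A$: (1) $(x\dashv y)\dashv z=x\dashv(y\dashv z)$; (2) $(x\vdash y)\vdash z=x\vdash(y\vdash z)$; (3) $(x\perp y)\perp z=x\perp(y\perp z)$; (4) $(x\dashv y)\dashv z=x\dashv(y\vdash z)$; (5) $(x\dashv y)\dashv z=x\dashv(y\perp z)$; (6) $(x\vdash y)\dashv z=x\vdash(y\dashv z)$; (7) $(x\dashv y)\vdash z=x\vdash(y\vdash z)$; (8) $(x\perp y)\vdash z=x\vdash(y\vdash z)$; (9) $(x\perp y)\dashv z=x\perp(y\dashv z)$; (10) $(x\dashv y)\perp z=x\perp(y\vdash z)$; (11) $(x\vdash y)\perp z=x\vdash(y\perp z)$. A morphism of triassociative algebras is a linear map preserving each of the three products (left to left, middle to middle, right to right). A linear map $\varphi:A\to A$ is, when the stated identity holds for all $x,y\in A$ and for each $\cdot\in\{\dashv,\perp,\vdash\}$: a Rota-Baxter operator of weight $\lambda$ if $\varphi(x)\cdot\varphi(y)=\varphi(\varphi(x)\cdot y+x\cdot\varphi(y)+\lambda\,x\cdot y)$; a Nijenhuis operator if $\varphi(x)\cdot\varphi(y)=\varphi(\varphi(x)\cdot y+x\cdot\varphi(y)-\varphi(x\cdot y))$; a Reynolds operator if $\varphi(x)\cdot\varphi(y)=\varphi(\varphi(x)\cdot y+x\cdot\varphi(y)-\varphi(x)\cdot\varphi(y))$. On $(A,\triangleleft,\triangle,\triangleright)$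 the left, middle and right products are $\triangleleft,\triangle,\triangleright$ respectively. *)

theory Defs
  imports Complex_Main
begin

text \<open>The constant \<^term>\<open>Vector_Spaces.linear\<close> is the library's notion of a linear map
  between vector spaces over an arbitrary field; it includes the vector space axioms.
  The library's bilinear maps exist over the reals only, hence the following.\<close>

definition bilinear_over ::
  "('k::field \<Rightarrow> 'a::ab_group_add \<Rightarrow> 'a) \<Rightarrow> ('a \<Rightarrow> 'a \<Rightarrow> 'a) \<Rightarrow> bool" where
  "bilinear_over scale p \<longleftrightarrow>
     (\<forall>x. Vector_Spaces.linear scale scale (\<lambda>y. p x y)) \<and>
     (\<forall>y. Vector_Spaces.linear scale scale (\<lambda>x. p x y))"

locale triassociative_algebra = vector_space scale
  for scale :: "'k::field \<Rightarrow> 'a::ab_group_add \<Rightarrow> 'a" +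
  fixes left :: "'a \<Rightarrow> 'a \<Rightarrow> 'a" (infixl "\<stileturn>" 70)
    and middle :: "'a \<Rightarrow> 'a \<Rightarrow> 'a" (infixl "\<bottom>" 70)
    and right :: "'a \<Rightarrow> 'a \<Rightarrow> 'a" (infixl "\<turnstile>" 70)
  assumes bilinear_left: "bilinear_over scale left"
    and bilinear_middle: "bilinear_over scale middle"
    and bilinear_right: "bilinear_over scale right"
    and left_assoc: "(x \<stileturn> y) \<stileturn> z = x \<stileturn> (y \<stileturn> z)"
    and right_assoc: "(x \<turnstile> y) \<turnstile> z = x \<turnstile> (y \<turnstile> z)"
    and middle_assoc: "(x \<bottom> y) \<bottom> z = x \<bottom> (y \<bottom> z)"
    and left_left_right: "(x \<stileturn> y) \<stileturn> z = x \<stileturn> (y \<turnstile> z)"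
    and left_left_middle: "(x \<stileturn> y) \<stileturn> z = x \<stileturn> (y \<bottom> z)"
    and right_left: "(x \<turnstile> y) \<stileturn> z = x \<turnstile> (y \<stileturn> z)"
    and left_right_right: "(x \<stileturn> y) \<turnstile> z = x \<turnstile> (y \<turnstile> z)"
    and middle_right_right: "(x \<bottom> y) \<turnstile> z = x \<turnstile> (y \<turnstile> z)"
    and middle_left: "(x \<bottom> y) \<stileturn> z = x \<bottom> (y \<stileturn> z)"
    and left_middle_right: "(x \<stileturn> y) \<bottom> z = x \<bottom> (y \<turnstile> z)"
    and right_middle: "(x \<turnstile> y) \<bottom> z = x \<turnstile> (y \<bottom> z)"

locale triassociative_morphism =
  dom: triassociative_algebra scale\<^sub>1 left\<^sub>1 middle\<^sub>1 right\<^sub>1 +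
  cod: triassociative_algebra scale\<^sub>2 left\<^sub>2 middle\<^sub>2 right\<^sub>2
  for scale\<^sub>1 :: "'k::field \<Rightarrow> 'a::ab_group_add \<Rightarrow> 'a"
    and left\<^sub>1 middle\<^sub>1 right\<^sub>1
    and scale\<^sub>2 :: "'k \<Rightarrow> 'b::ab_group_add \<Rightarrow> 'b"
    and left\<^sub>2 middle\<^sub>2 right\<^sub>2 +
  fixes f :: "'a \<Rightarrow> 'b"
  assumes linear: "Vector_Spaces.linear scale\<^sub>1 scale\<^sub>2 f"
    and map_left: "f (left\<^sub>1 x y) = left\<^sub>2 (f x) (f y)"
    and map_middle: "f (middle\<^sub>1 x y) = middle\<^sub>2 (f x) (f y)"
    and map_right: "f (right\<^sub>1 x y) = right\<^sub>2 (f x) (f y)"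

definition rota_baxter_operator ::
  "('k::field \<Rightarrow> 'a::ab_group_add \<Rightarrow> 'a) \<Rightarrow> ('a \<Rightarrow> 'a \<Rightarrow> 'a) \<Rightarrow> ('a \<Rightarrow> 'a \<Rightarrow> 'a) \<Rightarrow>
   ('a \<Rightarrow> 'a \<Rightarrow> 'a) \<Rightarrow> 'k \<Rightarrow> ('a \<Rightarrow> 'a) \<Rightarrow> bool" where
  "rota_baxter_operator scale left middle right lam \<phi> \<longleftrightarrow>
     Vector_Spaces.linear scale scale \<phi> \<and>
     (\<forall>p\<in>{left, middle, right}. \<forall>x y.
        p (\<phi> x) (\<phi> y) = \<phi> (p (\<phi> x) y + p x (\<phi> y) + scale lam (p x y)))"

definition nijenhuis_operator ::
  "('k::field \<Rightarrow> 'a::ab_group_add \<Rightarrow> 'a) \<Rightarrow> ('a \<Rightarrow> 'a \<Rightarrow> 'a) \<Rightarrow> ('a \<Rightarrow> 'a \<Rightarrow> 'a) \<Rightarrow>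
   ('a \<Rightarrow> 'a \<Rightarrow> 'a) \<Rightarrow> ('a \<Rightarrow> 'a) \<Rightarrow> bool" where
  "nijenhuis_operator scale left middle right \<phi> \<longleftrightarrow>
     Vector_Spaces.linear scale scale \<phi> \<and>
     (\<forall>p\<in>{left, middle, right}. \<forall>x y.
        p (\<phi> x) (\<phi> y) = \<phi> (p (\<phi> x) y + p x (\<phi> y) - \<phi> (p x y)))"

definition reynolds_operator ::
  "('k::field \<Rightarrow> 'a::ab_group_add \<Rightarrow> 'a) \<Rightarrow> ('a \<Rightarrow> 'a \<Rightarrow> 'a) \<Rightarrow> ('a \<Rightarrow> 'a \<Rightarrow> 'a) \<Rightarrow>
   ('a \<Rightarrow> 'a \<Rightarrow> 'a) \<Rightarrow> ('a \<Rightarrow> 'a) \<Rightarrow> bool" where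
  "reynolds_operator scale left middle right \<phi> \<longleftrightarrow>
     Vector_Spaces.linear scale scale \<phi> \<and>
     (\<forall>p\<in>{left, middle, right}. \<forall>x y.
        p (\<phi> x) (\<phi> y) = \<phi> (p (\<phi> x) y + p x (\<phi> y) - p (\<phi> x) (\<phi> y)))"

text \<open>The new left, middle and right products arise from the old ones by the same formula,
  which is therefore stated once, for a single product \<^term>\<open>p\<close>.\<close>

definition rota_baxter_product ::
  "('k::field \<Rightarrow> 'a::ab_group_add \<Rightarrow> 'a) \<Rightarrow> 'k \<Rightarrow> ('a \<Rightarrow> 'a) \<Rightarrow> ('a \<Rightarrow> 'a \<Rightarrow> 'a) \<Rightarrow> 'a \<Rightarrow> 'a \<Rightarrow> 'a" where
  "rota_baxter_product scale lam R p x y = p (R x) y + p x (R y) + scale lam (p x y)"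

definition nijenhuis_product ::
  "('a::ab_group_add \<Rightarrow> 'a) \<Rightarrow> ('a \<Rightarrow> 'a \<Rightarrow> 'a) \<Rightarrow> 'a \<Rightarrow> 'a \<Rightarrow> 'a" where
  "nijenhuis_product N p x y = p (N x) y + p x (N y) - N (p x y)"

definition reynolds_product ::
  "('a::ab_group_add \<Rightarrow> 'a) \<Rightarrow> ('a \<Rightarrow> 'a \<Rightarrow> 'a) \<Rightarrow> 'a \<Rightarrow> 'a \<Rightarrow> 'a" where
  "reynolds_product P p x y = p (P x) y + p x (P y) - p (P x) (P y)"

end

theory Submission
  imports Defs
begin

text \<open>Each of the three defining identities says \<open>\<phi> (x \<cdot>' y) = \<phi> x \<cdot> \<phi> y\<close>, where \<open>\<cdot>'\<close> is the
  product derived from \<open>\<cdot>\<close>. Expanding \<open>(x \<cdot>' y) \<cdot>' z\<close> and eliminating \<open>\<phi> (x \<cdot>' y)\<close> by this rule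
  leaves a combination of threefold products, all bracketed to the left, which is the mirror image
  of the expansion of \<open>x \<cdot>' (y \<cdot>' z)\<close>. Hence every identity of the shape
  \<open>(x \<cdot>\<^sub>1 y) \<cdot>\<^sub>2 z = x \<cdot>\<^sub>3 (y \<cdot>\<^sub>4 z)\<close> passes to the derived products, and all eleven axioms have
  this shape. Applying \<open>\<phi>\<close> once more shows that \<open>\<phi>\<close> keeps its defining identity.\<close>

section \<open>Linear and bilinear maps over a field\<close>

lemma bilinear_overD:
  assumes "bilinear_over scale p"
  shows "vector_space scale"
    and "p (x + y) z = p x z + p y z" "p x (y + z) = p x y + p x z"
    and "p (x - y) z = p x z - p y z" "p x (y - z) = p x y - p x z"
    and "p (scale c x) y = scale c (p x y)" "p x (scale c y) = scale c (p x y)"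
proof -
  have l: "Vector_Spaces.linear scale scale (\<lambda>x. p x y)" for y
    using assms by (simp add: bilinear_over_def)
  have r: "Vector_Spaces.linear scale scale (\<lambda>y. p x y)" for x
    using assms by (simp add: bilinear_over_def)
  show "vector_space scale" using l by (simp add: Vector_Spaces.linear_iff)
  show "p (x + y) z = p x z + p y z" "p (scale c x) y = scale c (p x y)"
    using l by (simp_all add: Vector_Spaces.linear_iff)
  show "p x (y + z) = p x y + p x z" "p x (scale c y) = scale c (p x y)"
    using r by (simp_all add: Vector_Spaces.linear_iff)
  show "p (x - y) z = p x z - p y z"
    using module_hom.diff[OF l[unfolded linear_iff_module_hom]] .
  show "p x (y - z) = p x y - p x z"
    using module_hom.diff[OF r[unfolded linear_iff_module_hom]] .
qed

lemma linear_overD: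
  assumes "Vector_Spaces.linear scale scale' f"
  shows "f (x + y) = f x + f y" "f (x - y) = f x - f y" "f (scale c x) = scale' c (f x)"
  using assms module_hom.diff[OF assms[unfolded linear_iff_module_hom]]
  by (simp_all add: Vector_Spaces.linear_iff)

lemma bilinear_overI:
  assumes "vector_space scale"
    and "\<And>x y z. p (x + y) z = p x z + p y z" "\<And>x y z. p x (y + z) = p x y + p x z"
    and "\<And>c x y. p (scale c x) y = scale c (p x y)" "\<And>c x y. p x (scale c y) = scale c (p x y)"
  shows "bilinear_over scale p"
  using assms by (simp add: bilinear_over_def Vector_Spaces.linear_iff)

section \<open>Bilinearity of the derived products\<close>

lemma bilinear_rota_baxter_product:
  assumes p: "bilinear_over scale p" and f: "Vector_Spaces.linear scale scale f"
  shows "bilinear_over scale (rota_baxter_product scale lam f p)"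
proof -
  interpret vector_space scale using p by (rule bilinear_overD)
  show ?thesis
    by (rule bilinear_overI)
      (simp_all add: vector_space_axioms rota_baxter_product_def bilinear_overD[OF p]
        linear_overD[OF f] scale_right_distrib scale_left_commute algebra_simps)
qed

lemma bilinear_nijenhuis_product:
  assumes p: "bilinear_over scale p" and f: "Vector_Spaces.linear scale scale f"
  shows "bilinear_over scale (nijenhuis_product f p)"
proof -
  interpret vector_space scale using p by (rule bilinear_overD)
  show ?thesis
    by (rule bilinear_overI)
      (simp_all add: vector_space_axioms nijenhuis_product_def bilinear_overD[OF p]
        linear_overD[OF f] scale_right_distrib scale_right_diff_distrib algebra_simps)
qed

lemma bilinear_reynolds_product:
  assumes p: "bilinear_over scale p" and f: "Vector_Spaces.linear scale scale f"
  shows "bilinear_over scale (reynolds_product f p)"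
proof -
  interpret vector_space scale using p by (rule bilinear_overD)
  show ?thesis
    by (rule bilinear_overI)
      (simp_all add: vector_space_axioms reynolds_product_def bilinear_overD[OF p]
        linear_overD[OF f] scale_right_distrib scale_right_diff_distrib algebra_simps)
qed

section \<open>Transfer of associativity-type identities\<close>

text \<open>Four independent operations let one computation serve all eleven axioms. Both sides
  expand into seven terms: \<open>f\<close> on two of the three arguments, on one with factor
  \<open>lam\<close>, on none with factor \<open>lam\<close> squared.\<close>

lemma rota_baxter_product_assoc:
  assumes q: "bilinear_over scale q" and r: "bilinear_over scale r"
    and assoc: "\<And>x y z. q (p x y) z = r x (s y z)"
    and fp: "\<And>x y. f (rota_baxter_product scale lam f p x y) = p (f x) (f y)"
    and fs: "\<And>x y. f (rota_baxter_product scale lam f s x y) = s (f x) (f y)"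
  shows "rota_baxter_product scale lam f q (rota_baxter_product scale lam f p x y) z =
    rota_baxter_product scale lam f r x (rota_baxter_product scale lam f s y z)"
proof -
  interpret vector_space scale using q by (rule bilinear_overD)
  let ?m = "rota_baxter_product scale lam f"
  \<comment> \<open>Only the outer product is unfolded, by the instance for \<open>q\<close>; the
    inner one stays folded so that \<open>fp\<close> can rewrite its image under
    \<open>f\<close>.\<close>
  have "?m q (?m p x y) z = q (p (f x) (f y)) z + q (?m p x y) (f z) + scale lam (q (?m p x y) z)"
    by (simp add: rota_baxter_product_def[of scale lam f q] fp)
  also have "\<dots> = r (f x) (?m s y z) + r x (s (f y) (f z)) + scale lam (r x (?m s y z))"
    by (simp add: rota_baxter_product_def bilinear_overD[OF q] bilinear_overD[OF r] assoc
        scale_right_distrib algebra_simps)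
  also have "\<dots> = ?m r x (?m s y z)"
    by (simp add: rota_baxter_product_def[of scale lam f r] fs)
  finally show ?thesis .
qed

text \<open>This is the Rota-Baxter expansion with \<open>-f\<close> in place of multiplication by
  \<open>lam\<close>. As \<open>f\<close> does not in general pull out of a product, the operator
  identity enters for the outer products \<open>q\<close> and \<open>r\<close> too.\<close>

lemma nijenhuis_product_assoc:
  assumes q: "bilinear_over scale q" and r: "bilinear_over scale r"
    and f: "Vector_Spaces.linear scale scale f"
    and assoc: "\<And>x y z. q (p x y) z = r x (s y z)"
    and fp: "\<And>x y. f (nijenhuis_product f p x y) = p (f x) (f y)"
    and fq: "\<And>x y. f (nijenhuis_product f q x y) = q (f x) (f y)"
    and fr: "\<And>x y. f (nijenhuis_product f r x y) = r (f x) (f y)"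
    and fs: "\<And>x y. f (nijenhuis_product f s x y) = s (f x) (f y)"
  shows "nijenhuis_product f q (nijenhuis_product f p x y) z =
    nijenhuis_product f r x (nijenhuis_product f s y z)"
proof -
  let ?m = "nijenhuis_product f"
  \<comment> \<open>The terms with \<open>f (p x y)\<close> or \<open>f (s y z)\<close> inside a product have no counterpart on the other
    side; they cancel once the identity for \<open>q\<close>, respectively \<open>r\<close>, is applied to them.\<close>
  have fq': "q (f (p x y)) (f z) =
      f (q (f (p x y)) z) + f (q (p x y) (f z)) - f (f (q (p x y) z))"
    using fq[of "p x y" z] by (simp add: nijenhuis_product_def linear_overD[OF f])
  have fr': "r (f x) (f (s y z)) =
      f (r (f x) (s y z)) + f (r x (f (s y z))) - f (f (r x (s y z)))"
    using fr[of x "s y z"] by (simp add: nijenhuis_product_def linear_overD[OF f])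
  have "?m q (?m p x y) z = q (p (f x) (f y)) z + q (?m p x y) (f z) - f (q (?m p x y) z)"
    by (simp add: nijenhuis_product_def[of f q] fp)
  also have "\<dots> = r (f x) (?m s y z) + r x (s (f y) (f z)) - f (r x (?m s y z))"
    by (simp add: nijenhuis_product_def bilinear_overD[OF q] bilinear_overD[OF r]
        linear_overD[OF f] fq' fr' assoc algebra_simps)
  also have "\<dots> = ?m r x (?m s y z)"
    by (simp add: nijenhuis_product_def[of f r] fs)
  finally show ?thesis .
qed

text \<open>Both sides expand into the three terms with \<open>f\<close> on exactly two arguments,
  minus twice the term with \<open>f\<close> on all three.\<close>

lemma reynolds_product_assoc:
  assumes q: "bilinear_over scale q" and r: "bilinear_over scale r"
    and assoc: "\<And>x y z. q (p x y) z = r x (s y z)"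
    and fp: "\<And>x y. f (reynolds_product f p x y) = p (f x) (f y)"
    and fs: "\<And>x y. f (reynolds_product f s x y) = s (f x) (f y)"
  shows "reynolds_product f q (reynolds_product f p x y) z =
    reynolds_product f r x (reynolds_product f s y z)"
proof -
  let ?m = "reynolds_product f"
  have "?m q (?m p x y) z =
      q (p (f x) (f y)) z + q (?m p x y) (f z) - q (p (f x) (f y)) (f z)"
    by (simp add: reynolds_product_def[of f q] fp)
  also have "\<dots> = r (f x) (?m s y z) + r x (s (f y) (f z)) - r (f x) (s (f y) (f z))"
    by (simp add: reynolds_product_def bilinear_overD[OF q] bilinear_overD[OF r] assoc
        algebra_simps)
  also have "\<dots> = ?m r x (?m s y z)"
    by (simp add: reynolds_product_def[of f r] fs)
  finally show ?thesis .
qed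

section \<open>Derived triassociative algebras and their morphisms\<close>

text \<open>The map \<open>T\<close> from old to new products abstracts from the three formulas, so
  the eleven axioms are checked only once.\<close>

lemma derived_triassociative_morphism:
  assumes A: "triassociative_algebra scale left middle right"
    and f: "Vector_Spaces.linear scale scale f"
    and bilinear: "\<And>p. p \<in> {left, middle, right} \<Longrightarrow> bilinear_over scale (T p)"
    and assoc: "\<And>p q r s x y z. {p, q, r, s} \<subseteq> {left, middle, right} \<Longrightarrow>
      (\<And>x y z. q (p x y) z = r x (s y z)) \<Longrightarrow> T q (T p x y) z = T r x (T s y z)"
    and hom: "\<And>p x y. p \<in> {left, middle, right} \<Longrightarrow> f (T p x y) = p (f x) (f y)"
  shows "triassociative_morphism scale (T left) (T middle) (T right) scale left middle right f"
proof -
  interpret A: triassociative_algebra scale left middle right by (fact A)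
  have "triassociative_algebra scale (T left) (T middle) (T right)"
    \<comment> \<open>\<open>assoc\<close> reduces each new axiom to the old one with the same
      \<open>p\<close>, \<open>q\<close>, \<open>r\<close>, \<open>s\<close>. Three old axioms share
      the left-hand side \<open>left (left x y) z\<close>; flipping two of them lets
      \<open>A.left_assoc\<close> bring all right-hand sides to one normal form.\<close>
    by unfold_locales
      (rule bilinear assoc,
        simp_all add: A.left_assoc A.right_assoc A.middle_assoc A.right_left A.left_right_right
          A.middle_right_right A.middle_left A.left_middle_right A.right_middle
          flip: A.left_left_right A.left_left_middle)+
  then interpret D: triassociative_algebra scale "T left" "T middle" "T right" .
  show ?thesis
    by (intro triassociative_morphism.intro triassociative_morphism_axioms.intro)
      (simp_all add: A D.triassociative_algebra_axioms f hom)
qed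

lemma rota_baxter_product_morphism:
  assumes A: "triassociative_algebra scale left middle right"
    and R: "rota_baxter_operator scale left middle right lam R"
  defines "T \<equiv> rota_baxter_product scale lam R"
  shows "triassociative_morphism scale (T left) (T middle) (T right) scale left middle right R"
    and "rota_baxter_operator scale (T left) (T middle) (T right) lam R"
proof -
  interpret A: triassociative_algebra scale left middle right by (fact A)
  have lin: "Vector_Spaces.linear scale scale R"
    using R by (simp add: rota_baxter_operator_def)
  have bil: "bilinear_over scale p" if "p \<in> {left, middle, right}" for p
    using that A.bilinear_left A.bilinear_middle A.bilinear_right by auto
  have hom: "R (T p x y) = p (R x) (R y)" if "p \<in> {left, middle, right}" for p x y
    using R that unfolding rota_baxter_operator_def T_def rota_baxter_product_def by metis
  show "triassociative_morphism scale (T left) (T middle) (T right) scale left middle right R"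
    using A lin
  proof (rule derived_triassociative_morphism)
    show "bilinear_over scale (T p)" if "p \<in> {left, middle, right}" for p
      unfolding T_def using bil[OF that] lin by (rule bilinear_rota_baxter_product)
    show "T q (T p x y) z = T r x (T s y z)"
      if "{p, q, r, s} \<subseteq> {left, middle, right}" "\<And>x y z. q (p x y) z = r x (s y z)"
      for p q r s x y z
      unfolding T_def
      by (rule rota_baxter_product_assoc) (use that bil hom in \<open>auto simp: T_def\<close>)
  qed (fact hom)
  \<comment> \<open>\<open>T\<close> stays folded at first, so that \<open>hom\<close> carries
    \<open>R\<close> through each summand; the result is the definition of
    \<open>T p (R x) (R y)\<close>.\<close>
  have "T p (R x) (R y) = R (T p (R x) y + T p x (R y) + scale lam (T p x y))"
    if "p \<in> {left, middle, right}" for p x y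
    by (simp add: linear_overD[OF lin] hom[OF that])
      (simp add: T_def rota_baxter_product_def)
  then show "rota_baxter_operator scale (T left) (T middle) (T right) lam R"
    using lin by (auto simp: rota_baxter_operator_def)
qed

lemma nijenhuis_product_morphism:
  assumes A: "triassociative_algebra scale left middle right"
    and N: "nijenhuis_operator scale left middle right N"
  defines "T \<equiv> nijenhuis_product N"
  shows "triassociative_morphism scale (T left) (T middle) (T right) scale left middle right N"
    and "nijenhuis_operator scale (T left) (T middle) (T right) N"
proof -
  interpret A: triassociative_algebra scale left middle right by (fact A)
  have lin: "Vector_Spaces.linear scale scale N"
    using N by (simp add: nijenhuis_operator_def)
  have bil: "bilinear_over scale p" if "p \<in> {left, middle, right}" for p
    using that A.bilinear_left A.bilinear_middle A.bilinear_right by auto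
  have hom: "N (T p x y) = p (N x) (N y)" if "p \<in> {left, middle, right}" for p x y
    using N that unfolding nijenhuis_operator_def T_def nijenhuis_product_def by metis
  show "triassociative_morphism scale (T left) (T middle) (T right) scale left middle right N"
    using A lin
  proof (rule derived_triassociative_morphism)
    show "bilinear_over scale (T p)" if "p \<in> {left, middle, right}" for p
      unfolding T_def using bil[OF that] lin by (rule bilinear_nijenhuis_product)
    show "T q (T p x y) z = T r x (T s y z)"
      if "{p, q, r, s} \<subseteq> {left, middle, right}" "\<And>x y z. q (p x y) z = r x (s y z)"
      for p q r s x y z
      unfolding T_def
      by (rule nijenhuis_product_assoc) (use that bil lin hom in \<open>auto simp: T_def\<close>)
  qed (fact hom)
  \<comment> \<open>The doubly mapped term \<open>N (N (T p x y))\<close> becomes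
    \<open>N (p (N x) (N y))\<close>, the correction term of \<open>T p (N x) (N y)\<close>.\<close>
  have "T p (N x) (N y) = N (T p (N x) y + T p x (N y) - N (T p x y))"
    if "p \<in> {left, middle, right}" for p x y
    by (simp add: linear_overD[OF lin] hom[OF that])
      (simp add: T_def nijenhuis_product_def)
  then show "nijenhuis_operator scale (T left) (T middle) (T right) N"
    using lin by (auto simp: nijenhuis_operator_def)
qed

lemma reynolds_product_morphism:
  assumes A: "triassociative_algebra scale left middle right"
    and P: "reynolds_operator scale left middle right P"
  defines "T \<equiv> reynolds_product P"
  shows "triassociative_morphism scale (T left) (T middle) (T right) scale left middle right P"
    and "reynolds_operator scale (T left) (T middle) (T right) P"
proof -
  interpret A: triassociative_algebra scale left middle right by (fact A)
  have lin: "Vector_Spaces.linear scale scale P"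
    using P by (simp add: reynolds_operator_def)
  have bil: "bilinear_over scale p" if "p \<in> {left, middle, right}" for p
    using that A.bilinear_left A.bilinear_middle A.bilinear_right by auto
  have hom: "P (T p x y) = p (P x) (P y)" if "p \<in> {left, middle, right}" for p x y
    using P that unfolding reynolds_operator_def T_def reynolds_product_def by metis
  show "triassociative_morphism scale (T left) (T middle) (T right) scale left middle right P"
    using A lin
  proof (rule derived_triassociative_morphism)
    show "bilinear_over scale (T p)" if "p \<in> {left, middle, right}" for p
      unfolding T_def using bil[OF that] lin by (rule bilinear_reynolds_product)
    show "T q (T p x y) z = T r x (T s y z)"
      if "{p, q, r, s} \<subseteq> {left, middle, right}" "\<And>x y z. q (p x y) z = r x (s y z)"
      for p q r s x y z
      unfolding T_def
      by (rule reynolds_product_assoc) (use that bil hom in \<open>auto simp: T_def\<close>)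
  qed (fact hom)
  \<comment> \<open>The last summand maps to \<open>p (P (P x)) (P (P y))\<close>, the correction
    term of \<open>T p (P x) (P y)\<close>.\<close>
  have "T p (P x) (P y) = P (T p (P x) y + T p x (P y) - T p (P x) (P y))"
    if "p \<in> {left, middle, right}" for p x y
    by (simp add: linear_overD[OF lin] hom[OF that])
      (simp add: T_def reynolds_product_def)
  then show "reynolds_operator scale (T left) (T middle) (T right) P"
    using lin by (auto simp: reynolds_operator_def)
qed

theorem theorem2p1:
  fixes scale :: "'k::field \<Rightarrow> 'a::ab_group_add \<Rightarrow> 'a"
    and left middle right :: "'a \<Rightarrow> 'a \<Rightarrow> 'a"
    and lam :: 'k
    and R N P :: "'a \<Rightarrow> 'a"
  assumes "triassociative_algebra scale left middle right"
  shows "(rota_baxter_operator scale left middle right lam R \<longrightarrow>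
      (let left' = rota_baxter_product scale lam R left; middle' = rota_baxter_product scale lam R middle;
           right' = rota_baxter_product scale lam R right
       in triassociative_algebra scale left' middle' right' \<and>
          triassociative_morphism scale left' middle' right' scale left middle right R \<and>
          rota_baxter_operator scale left' middle' right' lam R)) \<and>
    (nijenhuis_operator scale left middle right N \<longrightarrow>
      (let left' = nijenhuis_product N left; middle' = nijenhuis_product N middle;
           right' = nijenhuis_product N right
       in triassociative_algebra scale left' middle' right' \<and>
          triassociative_morphism scale left' middle' right' scale left middle right N \<and>
          nijenhuis_operator scale left' middle' right' N)) \<and>
    (reynolds_operator scale left middle right P \<longrightarrow>
      (let left' = reynolds_product P left; middle' = reynolds_product P middle;
           right' = reynolds_product P right
       in triassociative_algebra scale left' middle' right' \<and>
          triassociative_morphism scale left' middle' right' scale left middle right P \<and>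
          reynolds_operator scale left' middle' right' P))"
  unfolding Let_def
  using rota_baxter_product_morphism[OF assms] nijenhuis_product_morphism[OF assms]
    reynolds_product_morphism[OF assms]
  \<comment> \<open>A morphism includes the axioms of its domain, which yields the claim that the
    new products are triassociative.\<close>
  by (blast dest: triassociative_morphism.axioms(1))

end
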